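(* Let $0<a\le\frac12$ and $1<p\le2$. There is a constant $C>0$ such that for every $f\in L^p(H_a)$ $$|\widehat f(0)|^p+\sum_{n\in\mathbb N}\big((1-a)a^{-n}\big)^{p\left(\frac52-\frac4p\right)}|\widehat f(n)|^p\le C\,\|f\|_{L^p(H_a)}^p .$$
   Context: $\mathbb N=\{1,2,\dots\}$, $\mathbb N_0=\mathbb N\cup\{0\}$. For $0<a\le\frac12$, $H_a$ is the Dunkl–Ramirez countable compact hypergroup: the one-point compactification $\mathbb N_0^*=\{0,1,2,\dots,\infty\}$ of $\mathbb N_0$ with convolution $\delta_m*\delta_n=\delta_{\min\{m,n\}}$ for $m\ne n$ in $\mathbb N_0$, $\delta_m*\delta_\infty=\delta_\infty*\delta_m=\delta_m$, $\delta_\infty*\delta_\infty=\delta_\infty$, and $(\delta_m*\delta_m)(\{t\})=0$ for $t<m$, $=\frac{1-2a}{1-a}$ for $t=m$, $=a^k$ for $t=m+k>m$, $=0$ for $t=\infty$. Its Haar measure is $\lambda(\{k\})=a^k(1-a)$ for $k<\infty$, $\lambda(\{\infty\})=0$, and $L^p(H_a)=L^p(H_a,\lambda)$. Its characters are $\chi_n$, $n\in\mathbb N_0$, with $\chi_n(k)=0$ if $k<n-1$, $\chi_n(k)=\frac{a}{a-1}$ if $k=n-1$, and $\chi_n(k)=1$ if $k\ge n$ (or $k=\infty$). The Fourier transform is $\widehat f(n)=\int_{H_a}f\,\overline{\chi_n}\,d\lambda$. *)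

theory Defs
  imports "HOL-Analysis.Analysis" "HOL-Library.Extended_Nat"
begin

text \<open>
  The space of the Dunkl--Ramirez hypergroup \<open>H\<^sub>a\<close>, the one-point compactification of the
  naturals, is rendered by the type \<^typ>\<open>enat\<close>. It is countable and Hausdorff, so each of its
  subsets is Borel, and every measure below lives on the full power set. Only the Haar measure
  and the characters of \<open>H\<^sub>a\<close> are needed; the convolution does not enter.
\<close>

definition dr_haar :: "real \<Rightarrow> enat measure" where
  "dr_haar a = point_measure UNIV
     (\<lambda>x. case x of enat k \<Rightarrow> ennreal (a ^ k * (1 - a)) | \<infinity> \<Rightarrow> 0)"

text \<open>
  The position \<open>k = n - 1\<close> is written \<open>k + 1 = n\<close>, avoiding truncated subtraction at \<open>n = 0\<close>:
  the character with index \<open>0\<close> is constantly \<open>1\<close>.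
\<close>

definition dr_char :: "real \<Rightarrow> nat \<Rightarrow> enat \<Rightarrow> complex" where
  "dr_char a n x = (case x of
       enat k \<Rightarrow> if k + 1 < n then 0
                 else if k + 1 = n then complex_of_real (a / (a - 1))
                 else 1
     | \<infinity> \<Rightarrow> 1)"

definition dr_fourier :: "real \<Rightarrow> (enat \<Rightarrow> complex) \<Rightarrow> nat \<Rightarrow> complex" where
  "dr_fourier a f n = (\<integral>x. f x * cnj (dr_char a n x) \<partial>dr_haar a)"

text \<open>\<open>L\<^sup>p\<close> is taken as a set of functions, without passing to classes modulo null sets.\<close>

definition Lp_space :: "real \<Rightarrow> 'a measure \<Rightarrow> ('a \<Rightarrow> complex) set" where
  "Lp_space p M =
     {f \<in> borel_measurable M. integrable M (\<lambda>x. norm (f x) powr p)}"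

definition Lp_norm :: "real \<Rightarrow> 'a measure \<Rightarrow> ('a \<Rightarrow> complex) \<Rightarrow> real" where
  "Lp_norm p M f = (\<integral>x. norm (f x) powr p \<partial>M) powr (1 / p)"

end

theory Submission
  imports Defs
begin

text \<open>
  Up to constants, \<open>|f^(n)| \<le> \<Sum>\<^bsub>k\<ge>n-1\<^esub> a\<^sup>k |f k|\<close>. As \<open>p \<le> 2\<close>, we have
  \<open>p (5/2 - 4/p) \<le> p - 1\<close>, so the weight is at most a multiple of \<open>a\<close> to the power \<open>-n (p - 1)\<close>.
  With \<open>h k = a\<^bsup>k/p\<^esup> |f k|\<close> and \<open>r = a\<^bsup>(p-1)/p\<^esup> < 1\<close>, the weighted transform at
  \<open>m + 1\<close> is then dominated by \<open>\<Sum>\<^sub>j r\<^sup>j h (m + j)\<close>, a convolution with a geometric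
  sequence, which is bounded on \<open>l\<^sup>p\<close>.
\<close>

text \<open>Jensen's inequality for \<open>s powr p\<close>, for weights of total mass at most
  \<open>W\<close>. It comes from Young's inequality with a free parameter \<open>y\<close>: the
  value \<open>y = 1\<close> gives a summable majorant, and the weighted mean gives the
  bound.\<close>

lemma suminf_weighted_powr_le:
  fixes w x :: "nat \<Rightarrow> real"
  assumes p: "p > 1" and w: "\<And>j. w j \<ge> 0" and x: "\<And>j. x j \<ge> 0"
    and sw: "summable w" and W: "suminf w \<le> W" "W > 0"
    and swx: "summable (\<lambda>j. w j * x j powr p)"
  shows "summable (\<lambda>j. w j * x j)"
    and "(\<Sum>j. w j * x j) powr p \<le> W powr (p - 1) * (\<Sum>j. w j * x j powr p)"
proof -
  define q where "q = p / (p - 1)"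
  have q: "q > 1" "1 / p + 1 / q = 1" "(p - 1) * q = p"
    using p by (simp_all add: q_def field_simps)
  \<comment> \<open>Since \<open>(p - 1) * q = p\<close>, this is the tangent line of
    \<open>s powr p / p\<close> at the point \<open>y\<close>, with equality for
    \<open>s = y\<close>.\<close>
  have young: "s * y powr (p - 1) \<le> s powr p / p + y powr p / q" if "s \<ge> 0" "y \<ge> 0" for s y :: real
    using Youngs_inequality[of p q s "y powr (p - 1)"] p q that by (simp add: powr_powr)
  have le: "w j * x j * y powr (p - 1) \<le> w j * x j powr p / p + y powr p / q * w j"
    if "y \<ge> 0" for j and y :: real
    using mult_left_mono[OF young[OF x that] w, of j j] by (simp add: algebra_simps)
  show sm: "summable (\<lambda>j. w j * x j)"
  proof (rule summable_comparison_test'[where N = 0])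
    show "summable (\<lambda>j. w j * x j powr p / p + 1 / q * w j)"
      by (intro summable_add summable_divide summable_mult swx sw)
    show "norm (w j * x j) \<le> w j * x j powr p / p + 1 / q * w j" for j
      using le[of 1 j] w[of j] x[of j] by simp
  qed
  define A where "A = (\<Sum>j. w j * x j)"
  define B where "B = (\<Sum>j. w j * x j powr p)"
  \<comment> \<open>This choice turns the left side \<open>A * y powr (p - 1)\<close> into
    \<open>W * y powr p\<close>, which absorbs the term with \<open>1 / q\<close> and leaves the
    factor \<open>1 / p\<close> on both sides.\<close>
  define y where "y = A / W"
  have A0: "A \<ge> 0" unfolding A_def by (intro suminf_nonneg sm mult_nonneg_nonneg w x)
  have y0: "y \<ge> 0" using A0 W by (simp add: y_def)
  have "A * y powr (p - 1) \<le> B / p + y powr p / q * suminf w"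
    unfolding A_def B_def
  proof (rule sums_le[OF le[OF y0]])
    show "(\<lambda>j. w j * x j * y powr (p - 1)) sums ((\<Sum>j. w j * x j) * y powr (p - 1))"
      by (intro sums_mult2 summable_sums sm)
    show "(\<lambda>j. w j * x j powr p / p + y powr p / q * w j)
        sums ((\<Sum>j. w j * x j powr p) / p + y powr p / q * suminf w)"
      by (intro sums_add sums_divide sums_mult summable_sums swx sw)
  qed
  also have "\<dots> \<le> B / p + y powr p / q * W"
    using W q by (intro add_left_mono mult_left_mono) auto
  finally have *: "A * y powr (p - 1) \<le> B / p + y powr p / q * W" .
  have "A * y powr (p - 1) = W * y powr p"
  proof (cases "A = 0")
    case False
    then have "y > 0" using A0 W by (simp add: y_def)
    then have "y powr p = y * y powr (p - 1)" by (simp add: powr_diff)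
    then show ?thesis using W by (simp add: y_def)
  qed (use p in \<open>auto simp: y_def\<close>)
  with * have "W * y powr p * (1 - 1 / q) \<le> B / p" by (simp add: algebra_simps)
  moreover have "1 - 1 / q = 1 / p" using q by simp
  ultimately have "W * y powr p \<le> B" using p by (simp add: field_simps)
  moreover have "W * y powr p = A powr p / W powr (p - 1)"
    using W A0 by (simp add: y_def powr_divide powr_diff)
  ultimately show "A powr p \<le> W powr (p - 1) * B"
    using W by (simp add: field_simps)
qed

text \<open>An instance of Young's inequality for the convolution of \<open>l^1\<close> with
  \<open>l^p\<close>. The weighted inequality with weights \<open>r ^ j\<close> costs
  \<open>W powr (p - 1)\<close>; after summing over \<open>m\<close>, the total mass of the weights
  costs one more factor \<open>W\<close>.\<close>

lemma geometric_convolution_powr_bound: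
  fixes h :: "nat \<Rightarrow> real"
  assumes p: "p > 1" and r: "0 \<le> r" "r < 1" and h: "\<And>k. h k \<ge> 0"
    and sh: "summable (\<lambda>k. h k powr p)"
  shows "summable (\<lambda>j. r ^ j * h (m + j))"
    and "summable (\<lambda>m. (\<Sum>j. r ^ j * h (m + j)) powr p)"
    and "(\<Sum>m. (\<Sum>j. r ^ j * h (m + j)) powr p) \<le> (1 / (1 - r)) powr p * (\<Sum>k. h k powr p)"
proof -
  define S where "S = (\<Sum>k. h k powr p)"
  define W where "W = 1 / (1 - r)"
  define T where "T = (\<lambda>m. \<Sum>j. r ^ j * h (m + j))"
  have W: "W > 0" using r by (simp add: W_def)
  have sr: "summable (\<lambda>j. r ^ j)" and sumr: "(\<Sum>j. r ^ j) = W"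
    using r by (simp_all add: summable_geometric suminf_geometric W_def)
  have hS: "(\<Sum>k<n. h (k + j) powr p) \<le> S" for n j
  proof -
    have "(\<Sum>k<n. h (k + j) powr p) = (\<Sum>k\<in>{j..<n+j}. h k powr p)"
      by (simp add: sum.shift_bounds_nat_ivl[of _ 0 j n, simplified] lessThan_atLeast0)
    also have "\<dots> \<le> S"
      unfolding S_def by (intro sum_le_suminf sh) auto
    finally show ?thesis .
  qed
  have sT: "summable (\<lambda>j. r ^ j * h (m + j) powr p)" for m
  proof (rule summable_comparison_test'[where N = 0])
    show "summable (\<lambda>j. h (j + m) powr p)" using sh by (subst summable_iff_shift)
    show "norm (r ^ j * h (m + j) powr p) \<le> h (j + m) powr p" for j
      using r by (simp add: add.commute abs_mult mult_left_le_one_le power_le_one)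
  qed
  show "summable (\<lambda>j. r ^ j * h (m + j))" for m
    by (rule suminf_weighted_powr_le(1)[OF p _ _ sr _ W sT]) (use r h sumr in auto)
  have T: "T m powr p \<le> W powr (p - 1) * (\<Sum>j. r ^ j * h (m + j) powr p)" for m
    unfolding T_def
    by (rule suminf_weighted_powr_le(2)[OF p _ _ sr _ W sT]) (use r h sumr in auto)
  have bound: "(\<Sum>m<n. T m powr p) \<le> W powr p * S" for n
  proof -
    have "(\<Sum>m<n. T m powr p) \<le> W powr (p - 1) * (\<Sum>m<n. \<Sum>j. r ^ j * h (m + j) powr p)"
      unfolding sum_distrib_left by (intro sum_mono T)
    \<comment> \<open>Bounding only partial sums over \<open>m\<close> means that a finite sum is
      interchanged with a series; nonnegativity then passes the uniform bound to the full
      sum.\<close>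
    also have "(\<Sum>m<n. \<Sum>j. r ^ j * h (m + j) powr p) = (\<Sum>j. \<Sum>m<n. r ^ j * h (m + j) powr p)"
      by (intro suminf_sum[symmetric] sT)
    also have "\<dots> \<le> (\<Sum>j. r ^ j * S)"
    proof (intro suminf_le summable_sum sT summable_mult2 sr)
      show "(\<Sum>m<n. r ^ j * h (m + j) powr p) \<le> r ^ j * S" for j
        unfolding sum_distrib_left[symmetric] using r by (intro mult_left_mono hS) auto
    qed
    also have "\<dots> = W * S" using sr sumr by (simp add: suminf_mult2[symmetric])
    also have "W powr (p - 1) * (W * S) = W powr p * S" using W by (simp add: powr_diff)
    finally show ?thesis using W by (simp add: mult_left_mono)
  qed
  have "summable (\<lambda>m. T m powr p)"
    by (rule summableI_nonneg_bounded[OF _ bound]) simp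
  then show "summable (\<lambda>m. (\<Sum>j. r ^ j * h (m + j)) powr p)"
    and "(\<Sum>m. (\<Sum>j. r ^ j * h (m + j)) powr p) \<le> (1 / (1 - r)) powr p * (\<Sum>k. h k powr p)"
    using suminf_le_const[OF _ bound] by (simp_all add: T_def W_def S_def)
qed

text \<open>The density vanishes at infinity, so only \<open>range enat\<close> contributes and the
  integral is a series over the naturals. For nonnegative \<open>g\<close> integrability, that is
  absolute summability, is plain summability.\<close>

lemma dr_haar_nonneg:
  fixes g :: "enat \<Rightarrow> real"
  assumes a: "0 < a" "a < 1" and g: "\<And>x. g x \<ge> 0"
  shows integrable_dr_haar_iff:
      "integrable (dr_haar a) g \<longleftrightarrow> summable (\<lambda>k. a ^ k * g (enat k))" (is ?I)
    and integral_dr_haar: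
      "summable (\<lambda>k. a ^ k * g (enat k)) \<Longrightarrow>
        (\<integral>x. g x \<partial>dr_haar a) = (1 - a) * (\<Sum>k. a ^ k * g (enat k))"
proof -
  define d where "d = (\<lambda>x. case x of enat k \<Rightarrow> a ^ k * (1 - a) | \<infinity> \<Rightarrow> 0)"
  have d0: "d x \<ge> 0" for x using a by (simp add: d_def split: enat.split)
  have haar: "dr_haar a = density (count_space UNIV) (\<lambda>x. ennreal (d x))"
    unfolding dr_haar_def point_measure_def d_def
    by (intro arg_cong2[where f = density] ext refl) (simp split: enat.split)
  have bij: "bij_betw enat UNIV (range enat)"
    by (simp add: inj_on_imp_bij_betw inj_on_def)
  have d_out: "d x = 0" if "x \<notin> range enat" for x
    using that by (cases x) (auto simp: d_def)
  have "integrable (dr_haar a) g \<longleftrightarrow> Infinite_Set_Sum.abs_summable_on (\<lambda>x. d x * g x) UNIV"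
    unfolding haar abs_summable_on_def by (subst integrable_density) (use d0 in auto)
  also have "\<dots> \<longleftrightarrow> Infinite_Set_Sum.abs_summable_on (\<lambda>x. d x * g x) (range enat)"
    by (intro abs_summable_on_cong_neutral) (auto simp: d_out)
  also have "\<dots> \<longleftrightarrow> Infinite_Set_Sum.abs_summable_on (\<lambda>k. d (enat k) * g (enat k)) UNIV"
    by (rule abs_summable_on_reindex_bij_betw[OF bij, symmetric])
  also have iff: "\<dots> \<longleftrightarrow> summable (\<lambda>k. a ^ k * g (enat k))"
  proof -
    have "norm (d (enat k) * g (enat k)) = (1 - a) * (a ^ k * g (enat k))" for k
      using a g by (simp add: d_def abs_mult)
    then show ?thesis using a unfolding abs_summable_on_nat_iff'
      by (simp add: summable_cmult_iff)
  qed
  finally show ?I .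
  assume s: "summable (\<lambda>k. a ^ k * g (enat k))"
  have "(\<integral>x. g x \<partial>dr_haar a) = infsetsum (\<lambda>x. d x * g x) UNIV"
    unfolding haar infsetsum_def by (subst integral_density) (use d0 in auto)
  also have "\<dots> = infsetsum (\<lambda>x. d x * g x) (range enat)"
    by (intro infsetsum_cong_neutral) (auto simp: d_out)
  also have "\<dots> = infsetsum (\<lambda>k. d (enat k) * g (enat k)) UNIV"
    by (rule infsetsum_reindex_bij_betw[OF bij, symmetric])
  also have "\<dots> = (\<Sum>k. d (enat k) * g (enat k))"
    by (rule infsetsum_nat') (use s iff in simp)
  also have "\<dots> = (\<Sum>k. (1 - a) * (a ^ k * g (enat k)))" by (simp add: d_def mult_ac)
  also have "\<dots> = (1 - a) * (\<Sum>k. a ^ k * g (enat k))" by (rule suminf_mult[OF s])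
  finally show "(\<integral>x. g x \<partial>dr_haar a) = (1 - a) * (\<Sum>k. a ^ k * g (enat k))" .
qed

text \<open>The one value of modulus other than 0 and 1 is \<open>a / (a - 1)\<close>, and
  \<open>a / (1 - a) \<le> 1\<close> because \<open>a \<le> 1 / 2\<close>.\<close>

lemma norm_dr_char_le:
  assumes "0 < a" "a \<le> 1 / 2"
  shows "norm (dr_char a n (enat k)) \<le> (if k + 1 < n then 0 else 1)"
proof -
  have "cmod (complex_of_real (a / (a - 1))) \<le> 1"
    unfolding norm_of_real using assms by (simp add: field_simps)
  then show ?thesis by (simp add: dr_char_def)
qed

text \<open>The character vanishes before position \<open>n - 1\<close>, so only a tail of the
  series survives; the Haar factor \<open>1 - a\<close> is bounded by 1. With truncated subtraction
  the indices \<open>n = 0\<close> and \<open>n = 1\<close> both give the whole series, as they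
  should.\<close>

lemma norm_dr_fourier_le:
  assumes a: "0 < a" "a \<le> 1 / 2" and s: "summable (\<lambda>k. a ^ k * norm (f (enat k)))"
  shows "norm (dr_fourier a f n) \<le> (\<Sum>j. a ^ (n - 1 + j) * norm (f (enat (n - 1 + j))))"
proof -
  define u where "u = (\<lambda>k. a ^ k * norm (f (enat k)))"
  define v where "v = (\<lambda>k. a ^ k * norm (f (enat k) * cnj (dr_char a n (enat k))))"
  have v: "v k \<le> (if k + 1 < n then 0 else u k)" for k
  proof -
    have "v k = u k * norm (dr_char a n (enat k))"
      by (simp add: u_def v_def norm_mult)
    also have "\<dots> \<le> u k * (if k + 1 < n then 0 else 1)"
      using a by (intro mult_left_mono norm_dr_char_le) (simp_all add: u_def)
    finally show ?thesis by (simp split: if_split_asm)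
  qed
  have v0: "v k \<ge> 0" and u0: "u k \<ge> 0" for k using a by (simp_all add: v_def u_def)
  have vu: "v k \<le> u k" for k using v[of k] u0[of k] by (auto split: if_splits)
  have su: "summable u" using s by (simp add: u_def)
  have sv: "summable v"
    by (rule summable_comparison_test'[OF su, of 0]) (use v0 vu in auto)
  have "norm (dr_fourier a f n) \<le> (\<integral>x. norm (f x * cnj (dr_char a n x)) \<partial>dr_haar a)"
    unfolding dr_fourier_def by (rule integral_norm_bound)
  also have "\<dots> = (1 - a) * suminf v"
    unfolding v_def by (rule integral_dr_haar) (use a sv in \<open>auto simp: v_def\<close>)
  also have "\<dots> \<le> suminf v"
    using a suminf_nonneg[OF sv v0] by (intro mult_left_le_one_le) auto
  also have "\<dots> = (\<Sum>j. v (j + (n - 1))) + (\<Sum>k<n - 1. v k)"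
    by (rule suminf_split_initial_segment[OF sv])
  also have "(\<Sum>k<n - 1. v k) = 0"
  proof (rule sum.neutral, rule ballI)
    show "v k = 0" if "k \<in> {..<n - 1}" for k
      using v[of k] v0[of k] that by (auto split: if_splits)
  qed
  also have "(\<Sum>j. v (j + (n - 1))) + 0 \<le> (\<Sum>j. u (j + (n - 1)))"
    using sv su vu by (simp add: suminf_le)
  finally show ?thesis by (simp add: u_def add.commute)
qed

theorem theorem5p5:
  fixes a p :: real
  assumes "0 < a" and "a \<le> 1 / 2" and "1 < p" and "p \<le> 2"
  shows "\<exists>C>0. \<forall>f \<in> Lp_space p (dr_haar a).
     (\<lambda>n. ((1 - a) * a powi (- int n)) powr (p * (5 / 2 - 4 / p))
            * norm (dr_fourier a f n) powr p) summable_on {1..} \<and>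
     norm (dr_fourier a f 0) powr p
       + (\<Sum>\<^sub>\<infinity>n\<in>{1..}. ((1 - a) * a powi (- int n)) powr (p * (5 / 2 - 4 / p))
            * norm (dr_fourier a f n) powr p)
     \<le> C * Lp_norm p (dr_haar a) f powr p"
proof -
  define e where "e = p * (5 / 2 - 4 / p)"
  define wt where "wt = (\<lambda>n. ((1 - a) * a powi (- int n)) powr e)"
  define r where "r = a powr ((p - 1) / p)"
  \<comment> \<open>The factor \<open>a powr (1 - p)\<close> pays for the index shift
    \<open>n = m + 1\<close>. The exponent \<open>e\<close> may be negative, so
    \<open>(1 - a) powr e\<close> is kept rather than bounded by 1.\<close>
  define K where "K = (1 - a) powr e * a powr (1 - p)"
  \<comment> \<open>In \<open>1 + K\<close> the 1 accounts for the coefficient at 0 and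
    \<open>K\<close> for all others; the division by \<open>1 - a\<close> undoes the Haar
    normalisation in the norm.\<close>
  define C where "C = (1 + K) * (1 / (1 - r)) powr p / (1 - a)"
  have a1: "a < 1" and p0: "p > 0" using assms by auto
  have r: "0 < r" "r < 1"
    using assms a1 powr_less_mono'[of a 0 "(p - 1) / p"] by (simp_all add: r_def)
  \<comment> \<open>Here \<open>e = 5 * p / 2 - 4\<close>, so the claim amounts to
    \<open>3 * p / 2 \<le> 3\<close>.\<close>
  have e: "e \<le> p - 1" using assms by (simp add: e_def right_diff_distrib)
  have K: "K > 0" using assms a1 by (simp add: K_def)
  have C: "C > 0" using K r a1 by (simp add: C_def)
  have wt: "wt (Suc m) \<le> K * a powr (- real m * (p - 1))" for m
  proof -
    have "a powi (- int (Suc m)) = a powr (- real (Suc m))"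
      using assms(1) powr_real_of_int'[of a "- int (Suc m)"] by simp
    then have "wt (Suc m) = (1 - a) powr e * a powr (- real (Suc m) * e)"
      unfolding wt_def using assms(1) a1 by (simp only: powr_mult powr_powr)
    \<comment> \<open>Two reversals occur: \<open>-real (Suc m)\<close> is negative, and
      \<open>a powr x\<close> decreases in \<open>x\<close> as \<open>a < 1\<close>.\<close>
    also have "\<dots> \<le> (1 - a) powr e * a powr (- real (Suc m) * (p - 1))"
      using assms(1) a1 e
      by (intro mult_left_mono powr_mono' mult_left_mono_neg) auto
    also have "\<dots> = K * a powr (- real m * (p - 1))"
      by (simp add: K_def powr_add[symmetric] algebra_simps)
    finally show ?thesis .
  qed
  have main: "(\<lambda>n. wt n * norm (dr_fourier a f n) powr p) summable_on {1..} \<and>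
     norm (dr_fourier a f 0) powr p + (\<Sum>\<^sub>\<infinity>n\<in>{1..}. wt n * norm (dr_fourier a f n) powr p)
     \<le> C * Lp_norm p (dr_haar a) f powr p" if f: "f \<in> Lp_space p (dr_haar a)" for f
  proof -
    define h where "h = (\<lambda>k. a powr (real k / p) * norm (f (enat k)))"
    define T where "T = (\<lambda>m. \<Sum>j. r ^ j * h (m + j))"
    define S where "S = (\<Sum>k. h k powr p)"
    have hp: "h k powr p = a ^ k * norm (f (enat k)) powr p" for k
      using assms p0 by (simp add: h_def powr_mult powr_powr powr_realpow)
    have h0: "h k \<ge> 0" for k by (simp add: h_def)
    have int: "integrable (dr_haar a) (\<lambda>x. norm (f x) powr p)"
      using f by (simp add: Lp_space_def)
    then have sh: "summable (\<lambda>k. h k powr p)"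
      using integrable_dr_haar_iff[of a "\<lambda>x. norm (f x) powr p"] assms a1 by (simp add: hp)
    have intS: "(\<integral>x. norm (f x) powr p \<partial>dr_haar a) = (1 - a) * S"
      unfolding S_def hp by (rule integral_dr_haar) (use assms a1 sh in \<open>auto simp: hp\<close>)
    have S0: "S \<ge> 0" unfolding S_def by (intro suminf_nonneg sh) simp
    have norm: "Lp_norm p (dr_haar a) f powr p = (1 - a) * S"
      using a1 S0 p0 by (simp add: Lp_norm_def intS powr_powr)
    note conv = geometric_convolution_powr_bound[OF assms(3) less_imp_le[OF r(1)] r(2) h0 sh]
    have T0: "T m \<ge> 0" for m unfolding T_def using conv(1) r h0 by (intro suminf_nonneg) auto
    \<comment> \<open>For \<open>k = m + j\<close>, split \<open>a ^ k\<close> into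
      \<open>a powr (k / p)\<close>, which goes into \<open>h\<close>, and
      \<open>a powr (k * (p - 1) / p)\<close>, whose \<open>j\<close>-part is \<open>r ^ j\<close>.
      The remaining \<open>m\<close>-part is what the weight will cancel.\<close>
    have rh: "a ^ (m + j) * norm (f (enat (m + j))) = a powr (real m * (p - 1) / p) * (r ^ j * h (m + j))"
      for m j
    proof -
      have "r ^ j = a powr (real j * (p - 1) / p)"
        using r assms by (simp add: r_def powr_realpow[symmetric] powr_powr mult_ac)
      moreover have "a ^ (m + j) = a powr (real m * (p - 1) / p + real j * (p - 1) / p + real (m + j) / p)"
      proof -
        have "real m * (p - 1) / p + real j * (p - 1) / p + real (m + j) / p = real (m + j)"
          using p0 by (simp add: divide_simps) (simp add: algebra_simps)
        then show ?thesis using assms(1) by (simp only: powr_realpow)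
      qed
      ultimately show ?thesis by (simp add: h_def powr_add)
    qed
    \<comment> \<open>At \<open>m = 0\<close> the prefactor in \<open>rh\<close> is 1, so the
      convolution lemma also yields the inclusion of \<open>L^p\<close> in
      \<open>L^1\<close>.\<close>
    have s: "summable (\<lambda>k. a ^ k * norm (f (enat k)))"
      using conv(1)[of 0] rh[of 0] assms by simp
    have F: "norm (dr_fourier a f n) \<le> a powr (real (n - 1) * (p - 1) / p) * T (n - 1)" for n
      using norm_dr_fourier_le[OF assms(1,2) s, of n] conv(1)
      unfolding rh T_def by (simp add: suminf_mult)
    have Fp: "norm (dr_fourier a f n) powr p \<le> a powr (real (n - 1) * (p - 1)) * T (n - 1) powr p" for n
      using powr_mono2[OF _ _ F, of p n] p0 T0 by (simp add: powr_mult powr_powr)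
    define G where "G = (\<lambda>m. wt (Suc m) * norm (dr_fourier a f (Suc m)) powr p)"
    have G0: "G m \<ge> 0" for m by (simp add: G_def wt_def)
    have G: "G m \<le> K * T m powr p" for m
    proof -
      \<comment> \<open>The powers of \<open>a\<close> from the weight and from the transform bound
        are reciprocal, so their product is 1.\<close>
      have "G m \<le> (K * a powr (- real m * (p - 1))) * (a powr (real m * (p - 1)) * T m powr p)"
        unfolding G_def using K Fp[of "Suc m"] by (intro mult_mono wt) auto
      also have "\<dots> = K * T m powr p * a powr (- real m * (p - 1) + real m * (p - 1))"
        by (simp only: powr_add mult_ac)
      finally show ?thesis using assms by simp
    qed
    have sT: "summable (\<lambda>m. T m powr p)" using conv(2) by (simp add: T_def)
    have sG: "summable G"
      by (rule summable_comparison_test'[OF summable_mult[OF sT, of K], of 0]) (use G G0 in auto)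
    have sumT: "(\<Sum>m. T m powr p) \<le> (1 / (1 - r)) powr p * S"
      using conv(3) by (simp add: T_def S_def)
    \<comment> \<open>Nonnegativity turns the ordered series into an unordered sum, which reindexing
      by \<open>Suc\<close> moves to \<open>{1..}\<close>.\<close>
    have "(G has_sum suminf G) UNIV"
      by (rule sums_nonneg_imp_has_sum[OF summable_sums[OF sG] G0])
    moreover have "range Suc = {1..}"
      by (auto simp: image_iff Suc_le_eq gr0_conv_Suc)
    ultimately have hs: "((\<lambda>n. wt n * norm (dr_fourier a f n) powr p) has_sum suminf G) {1..}"
      using has_sum_reindex[of Suc UNIV "\<lambda>n. wt n * norm (dr_fourier a f n) powr p" "suminf G"]
      by (simp add: G_def o_def)
    \<comment> \<open>Since \<open>0 - 1 = 0\<close> on the naturals, the coefficient at 0 obeys the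
      same bound by \<open>T 0\<close> as the one at 1.\<close>
    have "norm (dr_fourier a f 0) powr p \<le> T 0 powr p" using Fp[of 0] assms by simp
    also have "\<dots> \<le> (\<Sum>m. T m powr p)"
      using sum_le_suminf[OF sT, of "{0}"] by simp
    finally have "norm (dr_fourier a f 0) powr p + suminf G \<le> (1 + K) * (\<Sum>m. T m powr p)"
      using suminf_le[OF G sG summable_mult[OF sT]] suminf_mult[OF sT, of K]
      by (simp add: algebra_simps)
    also have "\<dots> \<le> (1 + K) * ((1 / (1 - r)) powr p * S)"
      using K by (intro mult_left_mono sumT) auto
    also have "\<dots> = C * ((1 - a) * S)" using a1 by (simp add: C_def)
    finally show ?thesis
      using hs by (auto simp: norm infsumI summable_on_def)
  qed
  show ?thesis
    using C main unfolding wt_def e_def by blast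
qed

end
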